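(* Let $q\ge2$ be a fixed integer and let $p=p(n)\in(0,1]$ be a sequence with $pn/\log n\to\infty$ and $np^2\to0$. Then asymptotically almost surely $\Gamma=G(n,p)$ contains a spanning triangle-free subgraph $H$ with $$\delta(H)=(1-o(1))pn,\qquad \operatorname{del}_q(H)=\left(\frac1{2q}+o(1)\right)pn^2.$$
   Context: All graphs are finite and simple. $G(n,p)$ is the binomial random graph on vertex set $[n]$, in which each pair of vertices is an edge independently with probability $p=p(n)$. An event holds asymptotically almost surely if its probability tends to $1$ as $n\to\infty$. A subgraph is spanning if its vertex set is $[n]$. $\delta$ denotes minimum degree. Logarithms are natural, and asymptotic notation refers to $n\to\infty$. For a graph $G$ and an integer $q\ge2$, $$\operatorname{del}_q(G)=\min_{\phi:V(G)\to[q]}\bigl|\{xy\in E(G):\phi(x)=\phi(y)\}\bigr|,$$ i.e. the minimum number of edges whose deletion makes $G$ $q$-partite. *)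

theory Defs
  imports "HOL-Probability.Probability"
begin

record 'a ugraph =
  verts :: "'a set"
  edges :: "'a set set"

definition pairs :: "'a set \<Rightarrow> 'a set set" where
  "pairs V = {e. e \<subseteq> V \<and> card e = 2}"

definition simple_graph :: "'a ugraph \<Rightarrow> bool" where
  "simple_graph G \<longleftrightarrow> finite (verts G) \<and> edges G \<subseteq> pairs (verts G)"

definition spanning_subgraph :: "'a ugraph \<Rightarrow> 'a ugraph \<Rightarrow> bool" where
  "spanning_subgraph H G \<longleftrightarrow>
     simple_graph H \<and> simple_graph G \<and> verts H = verts G \<and> edges H \<subseteq> edges G"

definition triangle_free :: "'a ugraph \<Rightarrow> bool" where
  "triangle_free G \<longleftrightarrow>
     \<not> (\<exists>x y z. x \<noteq> y \<and> y \<noteq> z \<and> x \<noteq> z \<and>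
          {x, y} \<in> edges G \<and> {y, z} \<in> edges G \<and> {x, z} \<in> edges G)"

definition degree :: "'a ugraph \<Rightarrow> 'a \<Rightarrow> nat" where
  "degree G v = card {e \<in> edges G. v \<in> e}"

text \<open>Unspecified (minimum of the empty set) on the graph without vertices.\<close>

definition min_degree :: "'a ugraph \<Rightarrow> nat" where
  "min_degree G = Min (degree G ` verts G)"

definition mono_edges :: "'a ugraph \<Rightarrow> ('a \<Rightarrow> nat) \<Rightarrow> 'a set set" where
  "mono_edges G \<phi> = {e \<in> edges G. \<exists>x y. e = {x, y} \<and> \<phi> x = \<phi> y}"

text \<open>Colourings are extensional functions, so that there are only finitely many of them.\<close>

definition del :: "nat \<Rightarrow> 'a ugraph \<Rightarrow> nat" where
  "del q G = Min ((\<lambda>\<phi>. card (mono_edges G \<phi>)) ` (verts G \<rightarrow>\<^sub>E {1..q}))"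

definition gnp :: "nat \<Rightarrow> real \<Rightarrow> nat ugraph pmf" where
  "gnp n p =
     map_pmf (\<lambda>f. \<lparr>verts = {1..n}, edges = {e \<in> pairs {1..n}. f e}\<rparr>)
       (Pi_pmf (pairs {1..n}) False (\<lambda>_. bernoulli_pmf p))"

text \<open>Asymptotically almost surely.\<close>

definition aas :: "(nat \<Rightarrow> 'a pmf) \<Rightarrow> (nat \<Rightarrow> 'a \<Rightarrow> bool) \<Rightarrow> bool" where
  "aas M P \<longleftrightarrow> (\<lambda>n. measure_pmf.prob (M n) {x. P n x}) \<longlonglongrightarrow> 1"

end

theory Submission
  imports Defs "HOL-Real_Asymp.Real_Asymp"
begin

text \<open>Let \<open>H\<close> be \<open>\<Gamma>\<close> without all edges that lie in triangles. The number of these edges at a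
  vertex \<open>v\<close> is at most twice the number of edges of \<open>\<Gamma>\<close> inside the neighbourhood of \<open>v\<close>, which has
  about \<open>pn\<close> vertices and hence typically spans about \<open>(pn)\<^sup>2 p / 2 = pn \<cdot> np\<^sup>2 / 2 = o(pn)\<close> edges. By
  Chernoff bounds and \<open>pn \<gg> log n\<close> this holds at all vertices simultaneously, so the removal
  changes all degrees by \<open>o(pn)\<close> only. Every \<open>q\<close>-colouring has at least \<open>n\<^sup>2 / 2q - n / 2\<close>
  monochromatic pairs, and a union bound over the \<open>q\<^sup>n\<close> colourings shows that \<open>\<Gamma>\<close> contains at least
  \<open>(1 - o(1)) pn\<^sup>2 / 2q\<close> monochromatic edges for each of them. Conversely, a uniformly random
  colouring of \<open>H\<close> has \<open>e(H) / q\<close> monochromatic edges on average.\<close>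

section \<open>Exponential moments and the Chernoff method for random edge sets\<close>

text \<open>For negative \<open>x\<close>, put \<open>y = - x\<close>: since
  \<open>exp y \<ge> 1 + y\<close>, the claim reduces to (1 - y + y^2)(1 + y) = 1 + y^3 \<ge> 1.
  Both signs occur later, positive for upper tails and negative for lower tails.\<close>

lemma exp_le_quadratic:
  fixes x :: real
  assumes "\<bar>x\<bar> \<le> 1"
  shows "exp x \<le> 1 + x + x\<^sup>2"
proof (cases "x \<ge> 0")
  case True
  then show ?thesis using assms by (intro exp_bound) auto
next
  case False
  define y where "y = - x"
  have y: "0 < y" "y \<le> 1" using False assms by (auto simp: y_def)
  have "exp x = 1 / exp y" by (simp add: y_def exp_minus field_simps)
  also have "\<dots> \<le> 1 / (1 + y)"
    using y exp_ge_add_one_self[of y] by (intro divide_left_mono) auto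
  also have "\<dots> \<le> 1 - y + y\<^sup>2"
  proof -
    have "(1 - y + y\<^sup>2) * (1 + y) = 1 + y ^ 3"
      by (simp add: algebra_simps power2_eq_square power3_eq_cube)
    moreover have "1 \<le> 1 + y ^ 3" using y by simp
    ultimately have "1 \<le> (1 - y + y\<^sup>2) * (1 + y)" by simp
    then show ?thesis using y by (simp add: divide_le_eq)
  qed
  finally show ?thesis by (simp add: y_def)
qed

lemma finite_set_Pi_pmf_bool:
  fixes P :: "'a \<Rightarrow> bool pmf"
  assumes "finite E"
  shows "finite (set_pmf (Pi_pmf E False P))"
proof -
  have "finite (PiE_dflt E False (set_pmf \<circ> P))"
    using assms by (intro finite_PiE_dflt) auto
  then show ?thesis using assms set_Pi_pmf by (metis)
qed

lemma exp_times_card_eq_prod: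
  assumes "finite A"
  shows "exp (l * real (card {e\<in>A. f e})) = (\<Prod>e\<in>A. if f e then exp l else 1)"
proof -
  have "(\<Prod>e\<in>A. if f e then exp l else 1) = (\<Prod>e\<in>{e\<in>A. f e}. exp l)"
    using assms by (rule prod.inter_filter[symmetric])
  also have "\<dots> = exp (l * real (card {e\<in>A. f e}))"
    by (simp add: exp_of_nat2_mult)
  finally show ?thesis by simp
qed

text \<open>The indicator of prescribed values on \<open>D\<close> and the exponential of the count
  on \<open>A\<close> both factor over edges. As \<open>A\<close> and \<open>D\<close> are disjoint,
  each edge carries a single factor (1 outside both sets), and independence turns the expectation of
  the product into a product of expectations.\<close>

lemma expectation_Pi_bernoulli:
  fixes p l :: real
  assumes "finite E" "A \<subseteq> E" "D \<subseteq> E" "A \<inter> D = {}" "0 \<le> p" "p \<le> 1"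
  shows "measure_pmf.expectation (Pi_pmf E False (\<lambda>_. bernoulli_pmf p))
      (\<lambda>f. of_bool (\<forall>e\<in>D. f e = c e) * exp (l * real (card {e\<in>A. f e})))
    = (\<Prod>e\<in>D. if c e then p else 1 - p) * (1 + p * (exp l - 1)) ^ card A"
proof -
  define g where "g e b = (if e \<in> A then if b then exp l else 1
    else if e \<in> D then of_bool (b = c e) else (1 :: real))" for e b
  have fin: "finite A" "finite D" using assms finite_subset[of _ E] by auto
  have split: "(\<Prod>e\<in>E. h e) = (\<Prod>e\<in>A. h e) * (\<Prod>e\<in>D. h e)"
    if "\<And>e. e \<in> E \<Longrightarrow> e \<notin> A \<Longrightarrow> e \<notin> D \<Longrightarrow> h e = 1" for h :: "'a \<Rightarrow> real"
  proof -
    have "(\<Prod>e\<in>E. h e) = (\<Prod>e\<in>A \<union> D. h e)"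
      using assms that by (intro prod.mono_neutral_right) auto
    then show ?thesis using assms fin by (simp add: prod.union_disjoint)
  qed
  have g: "of_bool (\<forall>e\<in>D. f e = c e) * exp (l * real (card {e\<in>A. f e})) = (\<Prod>e\<in>E. g e (f e))" for f
  proof -
    have "(\<Prod>e\<in>E. g e (f e)) = (\<Prod>e\<in>A. g e (f e)) * (\<Prod>e\<in>D. g e (f e))"
      by (rule split) (auto simp: g_def)
    also have "(\<Prod>e\<in>A. g e (f e)) = exp (l * real (card {e\<in>A. f e}))"
      using fin by (auto simp: g_def exp_times_card_eq_prod intro!: prod.cong)
    also have "(\<Prod>e\<in>D. g e (f e)) = (\<Prod>e\<in>D. of_bool (f e = c e))"
      using assms by (intro prod.cong) (auto simp: g_def)
    also have "\<dots> = of_bool (\<forall>e\<in>D. f e = c e)"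
      using fin(2) by (induction D rule: finite_induct) auto
    finally show ?thesis by simp
  qed
  have "measure_pmf.expectation (Pi_pmf E False (\<lambda>_. bernoulli_pmf p)) (\<lambda>f. \<Prod>e\<in>E. g e (f e))
    = (\<Prod>e\<in>E. measure_pmf.expectation (bernoulli_pmf p) (g e))"
    using assms by (intro expectation_prod_Pi_pmf integrable_measure_pmf_finite)
      (auto simp: g_def intro: finite_subset[of _ UNIV])
  also have "\<dots> = (\<Prod>e\<in>E. g e True * p + g e False * (1 - p))"
    using assms by simp
  also have "\<dots> = (\<Prod>e\<in>A. g e True * p + g e False * (1 - p)) * (\<Prod>e\<in>D. g e True * p + g e False * (1 - p))"
    by (rule split) (auto simp: g_def)
  also have "(\<Prod>e\<in>A. g e True * p + g e False * (1 - p)) = (\<Prod>e\<in>A. 1 + p * (exp l - 1))"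
    by (intro prod.cong) (auto simp: g_def algebra_simps)
  also have "\<dots> = (1 + p * (exp l - 1)) ^ card A" by simp
  also have "(\<Prod>e\<in>D. g e True * p + g e False * (1 - p)) = (\<Prod>e\<in>D. if c e then p else 1 - p)"
    using assms by (intro prod.cong) (auto simp: g_def)
  finally show ?thesis by (simp add: g mult.commute)
qed

text \<open>Markov's inequality for \<open>exp (l * X)\<close> restricted to a cylinder. Stating the
  bound as a multiple of the cylinder's probability expresses conditioning without dividing by a
  number that may vanish. The factor \<open>l\<close> on both sides of the event covers upper tails
  (\<open>l > 0\<close>) and lower tails (\<open>l < 0\<close>) at once.\<close>

lemma Pi_bernoulli_cylinder_chernoff:
  fixes p l t :: real
  assumes "finite E" "A \<subseteq> E" "D \<subseteq> E" "A \<inter> D = {}" "0 \<le> p" "p \<le> 1"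
  defines "M \<equiv> Pi_pmf E False (\<lambda>_. bernoulli_pmf p)"
  shows "measure_pmf.prob M {f. (\<forall>e\<in>D. f e = c e) \<and> l * t \<le> l * real (card {e\<in>A. f e})}
    \<le> measure_pmf.prob M {f. \<forall>e\<in>D. f e = c e} * exp (p * real (card A) * (exp l - 1) - l * t)"
proof -
  have int: "integrable (measure_pmf M) h" for h :: "('a \<Rightarrow> bool) \<Rightarrow> real"
    unfolding M_def using assms by (intro integrable_measure_pmf_finite finite_set_Pi_pmf_bool)
  define X where "X f = real (card {e\<in>A. f e})" for f
  have E: "measure_pmf.expectation M (\<lambda>f. of_bool (\<forall>e\<in>D. f e = c e) * exp (l * X f))
      = (\<Prod>e\<in>D. if c e then p else 1 - p) * (1 + p * (exp l - 1)) ^ card A"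
    unfolding M_def X_def using assms by (intro expectation_Pi_bernoulli)
  \<comment> \<open>The same moment formula with an empty count set yields the probability of the
    cylinder.\<close>
  have C: "measure_pmf.prob M {f. \<forall>e\<in>D. f e = c e} = (\<Prod>e\<in>D. if c e then p else 1 - p)"
  proof -
    have "measure_pmf.prob M {f. \<forall>e\<in>D. f e = c e}
      = measure_pmf.expectation M (indicator {f. \<forall>e\<in>D. f e = c e})" by simp
    also have "\<dots> = measure_pmf.expectation M
        (\<lambda>f. of_bool (\<forall>e\<in>D. f e = c e) * exp (0 * real (card {e\<in>{}. f e})))"
      by (intro Bochner_Integration.integral_cong) (auto simp: indicator_def)
    also have "\<dots> = (\<Prod>e\<in>D. if c e then p else 1 - p) * (1 + p * (exp 0 - 1)) ^ card ({} :: 'a set)"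
      unfolding M_def using assms by (intro expectation_Pi_bernoulli) auto
    finally show ?thesis by simp
  qed
  have "measure_pmf.prob M {f. (\<forall>e\<in>D. f e = c e) \<and> l * t \<le> l * X f}
    = measure_pmf.expectation M (indicator {f. (\<forall>e\<in>D. f e = c e) \<and> l * t \<le> l * X f})" by simp
  also have "\<dots> \<le> measure_pmf.expectation M
      (\<lambda>f. (of_bool (\<forall>e\<in>D. f e = c e) * exp (l * X f)) * exp (- (l * t)))"
    by (intro integral_mono int) (auto simp: indicator_def exp_add[symmetric])
  also have "\<dots> = (\<Prod>e\<in>D. if c e then p else 1 - p) * (1 + p * (exp l - 1)) ^ card A * exp (- (l * t))"
    using E by simp
  \<comment> \<open>This is 1 + x \<le> exp x. Monotonicity of powers also needs a nonnegative base,
    which holds because the base averages 1 and \<open>exp l\<close> with weights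
    \<open>1 - p\<close> and \<open>p\<close>.\<close>
  also have "\<dots> \<le> (\<Prod>e\<in>D. if c e then p else 1 - p) * exp (p * (exp l - 1)) ^ card A * exp (- (l * t))"
  proof (intro mult_right_mono mult_left_mono power_mono prod_nonneg)
    have "1 + p * (exp l - 1) = (1 - p) + p * exp l" by (simp add: algebra_simps)
    moreover have "0 \<le> 1 - p" "0 \<le> p * exp l" using assms by auto
    ultimately show "0 \<le> 1 + p * (exp l - 1)" by linarith
  qed (use assms exp_ge_add_one_self[of "p * (exp l - 1)"] in auto)
  also have "\<dots> = (\<Prod>e\<in>D. if c e then p else 1 - p) * exp (p * real (card A) * (exp l - 1) - l * t)"
    by (simp add: exp_of_nat2_mult[symmetric] mult.assoc exp_add[symmetric] mult.commute[of "exp l - 1"])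
  finally show ?thesis by (simp add: C X_def)
qed

lemma Pi_bernoulli_chernoff:
  fixes p l t :: real
  assumes "finite E" "A \<subseteq> E" "0 \<le> p" "p \<le> 1"
  shows "measure_pmf.prob (Pi_pmf E False (\<lambda>_. bernoulli_pmf p)) {f. l * t \<le> l * real (card {e\<in>A. f e})}
    \<le> exp (p * real (card A) * (exp l - 1) - l * t)"
  using Pi_bernoulli_cylinder_chernoff[of E A "{}" p "\<lambda>_. True" l t] assms by simp

section \<open>From fixed tolerances to a null sequence\<close>

text \<open>Choose \<open>\<epsilon> n\<close> admissible and within 1/(n+1) of the infimum of all
  admissible values; the value 1 ensures that there is one for every \<open>n\<close>. Once
  \<open>r / 2\<close> is admissible, the infimum is at most \<open>r / 2\<close>, so
  \<open>\<epsilon> n < r\<close> for large \<open>n\<close>.\<close>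

lemma exists_null_sequence_of_eventually:
  assumes "\<And>\<epsilon>::real. \<epsilon> > 0 \<Longrightarrow> eventually (\<lambda>n. Q n \<epsilon>) sequentially"
    and "\<And>n. Q n 1"
  shows "\<exists>\<epsilon>. \<epsilon> \<longlonglongrightarrow> 0 \<and> (\<forall>n. Q n (\<epsilon> n))"
proof -
  define S where "S n = {\<epsilon>. \<epsilon> > 0 \<and> Q n \<epsilon>}" for n
  have ne: "S n \<noteq> {}" for n using assms(2) by (auto simp: S_def intro: exI[of _ 1])
  have bdd: "bdd_below (S n)" for n by (intro bdd_belowI[of _ 0]) (auto simp: S_def)
  have "\<exists>\<epsilon>\<in>S n. \<epsilon> < Inf (S n) + 1 / real (Suc n)" for n
    using cInf_lessD[OF ne, of n "Inf (S n) + 1 / real (Suc n)"] by auto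
  then obtain \<epsilon> where \<epsilon>: "\<And>n. \<epsilon> n \<in> S n" "\<And>n. \<epsilon> n < Inf (S n) + 1 / real (Suc n)"
    by metis
  have "\<epsilon> \<longlonglongrightarrow> 0"
  proof (rule tendstoI)
    fix r :: real assume r: "r > 0"
    have "eventually (\<lambda>n. Q n (r / 2)) sequentially" using assms(1) r by simp
    moreover have "eventually (\<lambda>n. 1 / real (Suc n) < r / 2) sequentially"
      using r by real_asymp
    ultimately show "eventually (\<lambda>n. dist (\<epsilon> n) 0 < r) sequentially"
    proof eventually_elim
      case (elim n)
      have "Inf (S n) \<le> r / 2" using elim r by (intro cInf_lower bdd) (auto simp: S_def)
      then show ?case using \<epsilon>[of n] elim by (auto simp: S_def)
    qed
  qed
  then show ?thesis using \<epsilon>(1) by (auto simp: S_def)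
qed

section \<open>Neighbourhoods and edges in triangles\<close>

definition star :: "'a set \<Rightarrow> 'a \<Rightarrow> 'a set set" where
  "star V v = {e \<in> pairs V. v \<in> e}"

definition nbrs :: "'a set set \<Rightarrow> 'a \<Rightarrow> 'a set" where
  "nbrs F v = {w. {v, w} \<in> F}"

text \<open>When \<open>F\<close> consists of two-element sets, membership of the three edges forces
  \<open>x\<close>, \<open>y\<close>, \<open>z\<close> to be distinct.\<close>

definition triangle_edges :: "'a set set \<Rightarrow> 'a set set" where
  "triangle_edges F = {e \<in> F. \<exists>x y z. e = {x, y} \<and> {y, z} \<in> F \<and> {x, z} \<in> F}"

definition mono_pairs :: "'a set \<Rightarrow> ('a \<Rightarrow> nat) \<Rightarrow> 'a set set" where
  "mono_pairs V \<phi> = {e \<in> pairs V. \<exists>x y. e = {x, y} \<and> \<phi> x = \<phi> y}"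

lemma finite_pairs: "finite V \<Longrightarrow> finite (pairs V)"
  by (rule finite_subset[of _ "Pow V"]) (auto simp: pairs_def)

lemma card_pairs: "finite V \<Longrightarrow> card (pairs V) = card V choose 2"
  by (simp add: pairs_def n_subsets)

lemma doubleton_in_pairs [simp]: "{x, y} \<in> pairs V \<longleftrightarrow> x \<in> V \<and> y \<in> V \<and> x \<noteq> y"
  by (auto simp: pairs_def card_insert_if)

lemma pairsE:
  assumes "e \<in> pairs V"
  obtains x y where "e = {x, y}" "x \<in> V" "y \<in> V" "x \<noteq> y"
  using assms by (auto simp: pairs_def card_2_iff)

lemma doubleton_inj: "inj_on (\<lambda>w. {v, w}) S"
  by (auto simp: inj_on_def doubleton_eq_iff)

lemma star_eq_image: "v \<in> V \<Longrightarrow> star V v = (\<lambda>w. {v, w}) ` (V - {v})"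
  by (fastforce simp: star_def elim!: pairsE)

lemma card_star: "v \<in> V \<Longrightarrow> finite V \<Longrightarrow> card (star V v) = card V - 1"
  by (simp add: star_eq_image card_image doubleton_inj)

lemma edges_at_eq_image:
  assumes "F \<subseteq> pairs V"
  shows "{e \<in> F. v \<in> e} = (\<lambda>w. {v, w}) ` nbrs F v"
proof -
  have "e \<in> (\<lambda>w. {v, w}) ` nbrs F v" if "e \<in> F" "v \<in> e" for e
  proof -
    have "e \<in> pairs V" using assms that by auto
    then obtain x y where "e = {x, y}" by (rule pairsE)
    then show ?thesis using that by (auto simp: nbrs_def insert_commute)
  qed
  then show ?thesis by (auto simp: nbrs_def)
qed

lemma card_edges_at:
  "F \<subseteq> pairs V \<Longrightarrow> card {e \<in> F. v \<in> e} = card (nbrs F v)"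
  by (simp add: edges_at_eq_image card_image doubleton_inj)

lemma nbrs_subset: "F \<subseteq> pairs V \<Longrightarrow> nbrs F v \<subseteq> V - {v}"
  unfolding nbrs_def using doubleton_in_pairs[of v _ V] by blast

lemma handshake:
  assumes "finite V" "F \<subseteq> pairs V"
  shows "(\<Sum>v\<in>V. card {e \<in> F. v \<in> e}) = 2 * card F"
proof (rule sum_multicount)
  show "finite F" using assms finite_pairs finite_subset by blast
  show "\<forall>e\<in>F. card {v \<in> V. v \<in> e} = 2"
  proof
    fix e assume "e \<in> F"
    then have "e \<subseteq> V" "card e = 2" using assms by (auto simp: pairs_def)
    moreover from this have "{v \<in> V. v \<in> e} = e" by auto
    ultimately show "card {v \<in> V. v \<in> e} = 2" by simp
  qed
qed fact

lemma triangle_free_minus_triangle_edges: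
  "triangle_free \<lparr>verts = V, edges = F - triangle_edges F\<rparr>"
  unfolding triangle_free_def
proof (rule notI, elim exE conjE, unfold ugraph.simps)
  fix x y z
  assume "{x, y} \<in> F - triangle_edges F" "{y, z} \<in> F - triangle_edges F"
    "{x, z} \<in> F - triangle_edges F"
  moreover from this have "{x, y} \<in> triangle_edges F"
    unfolding triangle_edges_def by blast
  ultimately show False by blast
qed

text \<open>If \<open>{v, w}\<close> lies in a triangle with third vertex \<open>z\<close>, then
  \<open>{w, z}\<close> is an edge inside the neighbourhood of \<open>v\<close>. So \<open>w\<close>
  is covered by these edges, and each of them covers two vertices, whence the factor 2.\<close>

lemma card_triangle_edges_at_le:
  assumes "finite V" "F \<subseteq> pairs V"
  shows "card {e \<in> triangle_edges F. v \<in> e} \<le> 2 * card (F \<inter> pairs (nbrs F v))"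
proof -
  define B where "B = F \<inter> pairs (nbrs F v)"
  have finF: "finite F" using assms finite_pairs finite_subset by blast
  have finB: "finite B" using finF by (simp add: B_def)
  have B2: "card b = 2" if "b \<in> B" for b using that by (auto simp: B_def pairs_def)
  have key: "w \<in> \<Union>B" if "{v, w} \<in> triangle_edges F" for w
  proof -
    have vw: "{v, w} \<in> F" using that by (simp add: triangle_edges_def)
    from that obtain x y z where xyz: "{v, w} = {x, y}" "{y, z} \<in> F" "{x, z} \<in> F"
      by (auto simp: triangle_edges_def)
    then have z: "{w, z} \<in> F" "{v, z} \<in> F" by (auto simp: doubleton_eq_iff)
    then have "w \<noteq> z" using assms doubleton_in_pairs[of w z V] by blast
    then have "{w, z} \<in> B" using z vw by (auto simp: B_def nbrs_def)
    then show ?thesis by auto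
  qed
  have "{e \<in> triangle_edges F. v \<in> e} \<subseteq> (\<lambda>w. {v, w}) ` \<Union>B"
  proof
    fix e assume e: "e \<in> {e \<in> triangle_edges F. v \<in> e}"
    then have "e \<in> {e \<in> F. v \<in> e}" by (auto simp: triangle_edges_def)
    then obtain w where "e = {v, w}" using edges_at_eq_image[OF assms(2)] by blast
    then show "e \<in> (\<lambda>w. {v, w}) ` \<Union>B" using e key by auto
  qed
  \<comment> \<open>Infinite sets have cardinality 0, so members of cardinality 2 are
    finite.\<close>
  moreover have finU: "finite (\<Union>B)"
    using finB B2 by (metis card.infinite finite_Union zero_neq_numeral)
  ultimately have "card {e \<in> triangle_edges F. v \<in> e} \<le> card (\<Union>B)"
    using surj_card_le by blast
  also have "\<dots> \<le> (\<Sum>b\<in>B. card b)" by (rule card_Union_le_sum_card)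
  also have "\<dots> = 2 * card B" using B2 by simp
  finally show ?thesis by (simp add: B_def)
qed

section \<open>Counting monochromatic pairs and averaging over colourings\<close>

text \<open>In the graph of monochromatic pairs a vertex of colour \<open>i\<close> has degree
  \<open>c i - 1\<close>. Double counting makes twice the number of pairs equal to the sum of the
  squared class sizes minus \<open>card V\<close>, and Cauchy-Schwarz over the \<open>q\<close>
  classes bounds that sum from below.\<close>

lemma card_mono_pairs_ge:
  assumes "finite V" "\<phi> \<in> V \<rightarrow> {1..q}" "q \<ge> 1"
  shows "real (card (mono_pairs V \<phi>)) \<ge> (real (card V))\<^sup>2 / (2 * real q) - real (card V) / 2"
proof -
  define c where "c i = card {v \<in> V. \<phi> v = i}" for i
  have fin: "finite {v \<in> V. \<phi> v = i}" for i using assms by simp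
  have at: "card {e \<in> mono_pairs V \<phi>. v \<in> e} = c (\<phi> v) - 1" if "v \<in> V" for v
  proof -
    have "card {e \<in> mono_pairs V \<phi>. v \<in> e} = card (nbrs (mono_pairs V \<phi>) v)"
      by (rule card_edges_at[of _ V]) (auto simp: mono_pairs_def)
    also have "nbrs (mono_pairs V \<phi>) v = {w \<in> V. \<phi> w = \<phi> v} - {v}"
      using that by (auto simp: nbrs_def mono_pairs_def doubleton_eq_iff)
    finally show ?thesis using that by (simp add: c_def fin)
  qed
  \<comment> \<open>Needed to carry the truncated subtraction \<open>c (\<phi> v) - 1\<close> over
    to the reals.\<close>
  have pos: "c (\<phi> v) \<ge> 1" if "v \<in> V" for v
    using that fin by (auto simp: c_def Suc_le_eq card_gt_0_iff)
  have "2 * real (card (mono_pairs V \<phi>)) = (\<Sum>v\<in>V. real (card {e \<in> mono_pairs V \<phi>. v \<in> e}))"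
    using handshake[of V "mono_pairs V \<phi>"] assms
    by (simp add: mono_pairs_def of_nat_sum[symmetric] del: of_nat_sum)
  also have "\<dots> = (\<Sum>v\<in>V. real (c (\<phi> v)) - 1)"
    using at pos by (intro sum.cong) (auto simp: of_nat_diff)
  also have "\<dots> = (\<Sum>v\<in>V. real (c (\<phi> v))) - real (card V)"
    by (simp add: sum_subtractf)
  also have "(\<Sum>v\<in>V. real (c (\<phi> v))) = (\<Sum>i\<in>{1..q}. \<Sum>v | v \<in> V \<and> \<phi> v = i. real (c (\<phi> v)))"
    using assms by (intro sum.group[symmetric]) auto
  also have "\<dots> = (\<Sum>i\<in>{1..q}. (real (c i))\<^sup>2)"
    by (simp add: c_def power2_eq_square)
  finally have 1: "2 * real (card (mono_pairs V \<phi>)) = (\<Sum>i\<in>{1..q}. (real (c i))\<^sup>2) - real (card V)" .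
  have "real (card V) = (\<Sum>v\<in>V. 1)" by simp
  also have "\<dots> = (\<Sum>i\<in>{1..q}. \<Sum>v | v \<in> V \<and> \<phi> v = i. 1)"
    using assms by (intro sum.group[symmetric]) auto
  also have "\<dots> = (\<Sum>i\<in>{1..q}. real (c i))" by (simp add: c_def)
  finally have "(real (card V))\<^sup>2 \<le> (\<Sum>i\<in>{1..q}. (real (c i))\<^sup>2) * real q"
    using sum_squared_le_sum_of_squares[of "\<lambda>i. real (c i)" "{1..q}"] by simp
  then have "(real (card V))\<^sup>2 / real q \<le> (\<Sum>i\<in>{1..q}. (real (c i))\<^sup>2)"
    using assms by (simp add: divide_le_eq)
  with 1 show ?thesis by (simp add: field_simps)
qed

lemma mono_edges_eq:
  "edges G \<subseteq> pairs V \<Longrightarrow> mono_edges G \<phi> = edges G \<inter> mono_pairs V \<phi>"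
  by (auto simp: mono_edges_def mono_pairs_def)

text \<open>A uniformly random colouring gives \<open>x\<close> and \<open>y\<close> equal colours
  with probability 1/q, stated without division. Such colourings correspond to colourings of
  \<open>V - {x}\<close>, as the colour of \<open>x\<close> is copied from \<open>y\<close>.\<close>

lemma card_monochromatic_colourings:
  assumes "finite V" "x \<in> V" "y \<in> V" "x \<noteq> y"
  shows "q * card {\<phi> \<in> V \<rightarrow>\<^sub>E {1..q}. \<phi> x = \<phi> y} = card (V \<rightarrow>\<^sub>E {1..q::nat})"
proof -
  define W where "W = V - {x}"
  have V: "V = insert x W" "x \<notin> W" "y \<in> W" "finite W" using assms by (auto simp: W_def)
  have "bij_betw (\<lambda>g. g(x := g y)) (W \<rightarrow>\<^sub>E {1..q}) {\<phi> \<in> V \<rightarrow>\<^sub>E {1..q}. \<phi> x = \<phi> y}"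
  \<comment> \<open>Extensional functions take the value \<open>undefined\<close> outside their
    domain, so this inverse is the restriction to \<open>W\<close>.\<close>
  proof (rule bij_betwI[where g = "\<lambda>\<phi>. \<phi>(x := undefined)"])
    show "(\<lambda>g. g(x := g y)) \<in> (W \<rightarrow>\<^sub>E {1..q}) \<rightarrow> {\<phi> \<in> V \<rightarrow>\<^sub>E {1..q}. \<phi> x = \<phi> y}"
      using V assms by (auto simp: PiE_def Pi_def extensional_def)
    show "(\<lambda>\<phi>. \<phi>(x := undefined)) \<in> {\<phi> \<in> V \<rightarrow>\<^sub>E {1..q}. \<phi> x = \<phi> y} \<rightarrow> (W \<rightarrow>\<^sub>E {1..q})"
      using V assms by (auto simp: PiE_def Pi_def extensional_def)
    show "(g(x := g y))(x := undefined) = g" if "g \<in> W \<rightarrow>\<^sub>E {1..q}" for g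
      using that V by (auto simp: PiE_def extensional_def)
    show "(\<phi>(x := undefined))(x := (\<phi>(x := undefined)) y) = \<phi>"
      if "\<phi> \<in> {\<phi> \<in> V \<rightarrow>\<^sub>E {1..q}. \<phi> x = \<phi> y}" for \<phi>
      using that assms by auto
  qed
  then have "card {\<phi> \<in> V \<rightarrow>\<^sub>E {1..q}. \<phi> x = \<phi> y} = card (W \<rightarrow>\<^sub>E {1..q})"
    by (simp add: bij_betw_same_card)
  also have "\<dots> = q ^ card W" using V by (simp add: card_PiE)
  finally show ?thesis using V by (simp add: card_PiE)
qed

text \<open>The minimum over colourings is at most the average. Counting pairs of a colouring and a
  monochromatic edge in two ways shows that the average is \<open>card (edges G)\<close> divided by
  \<open>q\<close>.\<close>

lemma del_le_average:
  assumes "finite (verts G)" "edges G \<subseteq> pairs (verts G)" "q \<ge> 1"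
  shows "q * del q G \<le> card (edges G)"
proof -
  let ?C = "verts G \<rightarrow>\<^sub>E {1..q}"
  have finC: "finite ?C" using assms by (intro finite_PiE) auto
  have finE: "finite (edges G)" using assms finite_pairs finite_subset by blast
  have cpos: "card ?C > 0" using assms by (simp add: card_PiE)
  have le: "del q G \<le> card (mono_edges G \<phi>)" if "\<phi> \<in> ?C" for \<phi>
    unfolding del_def using that finC by (intro Min_le) auto
  have "card ?C * (q * del q G) = q * (\<Sum>\<phi>\<in>?C. del q G)" by simp
  also have "\<dots> \<le> q * (\<Sum>\<phi>\<in>?C. card (mono_edges G \<phi>))"
    using le by (intro mult_left_mono sum_mono) auto
  also have "(\<Sum>\<phi>\<in>?C. card (mono_edges G \<phi>))
      = (\<Sum>e\<in>edges G. card {\<phi>\<in>?C. \<exists>x y. e = {x, y} \<and> \<phi> x = \<phi> y})"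
    unfolding mono_edges_def using finC finE by (intro sum_multicount_gen) auto
  also have "q * \<dots> = (\<Sum>e\<in>edges G. q * card {\<phi>\<in>?C. \<exists>x y. e = {x, y} \<and> \<phi> x = \<phi> y})"
    by (simp add: sum_distrib_left)
  also have "\<dots> = (\<Sum>e\<in>edges G. card ?C)"
  proof (rule sum.cong)
    fix e assume "e \<in> edges G"
    then have "e \<in> pairs (verts G)" using assms by auto
    then obtain x y where e: "e = {x, y}" "x \<in> verts G" "y \<in> verts G" "x \<noteq> y" by (rule pairsE)
    have "{\<phi>\<in>?C. \<exists>x y. e = {x, y} \<and> \<phi> x = \<phi> y} = {\<phi>\<in>?C. \<phi> x = \<phi> y}"
      by (auto simp: e doubleton_eq_iff)
    then show "q * card {\<phi>\<in>?C. \<exists>x y. e = {x, y} \<and> \<phi> x = \<phi> y} = card ?C"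
      using card_monochromatic_colourings[of "verts G" x y q] assms e by simp
  qed simp
  finally have "card ?C * (q * del q G) \<le> card ?C * card (edges G)" by (simp add: mult.commute)
  then show ?thesis using cpos by simp
qed

section \<open>Multiplicative tail bounds\<close>

text \<open>The choice \<open>l = \<delta> / 2\<close> minimises l^2 - \<delta> l, which remains as
  the coefficient of \<open>\<mu>\<close> after the quadratic bound on \<open>exp\<close>. Only an
  upper estimate \<open>\<mu>\<close> of the mean enters, so that n - 1 may be rounded up to
  n.\<close>

lemma Pi_bernoulli_upper_tail:
  fixes p \<delta> \<mu> :: real
  assumes "finite E" "A \<subseteq> E" "0 \<le> p" "p \<le> 1"
    and \<delta>: "0 < \<delta>" "\<delta> \<le> 1" and \<mu>: "p * real (card A) \<le> \<mu>"
  shows "measure_pmf.prob (Pi_pmf E False (\<lambda>_. bernoulli_pmf p))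
      {f. (1 + \<delta>) * \<mu> \<le> real (card {e\<in>A. f e})} \<le> exp (- (\<mu> * \<delta>\<^sup>2 / 4))"
proof -
  define l where "l = \<delta> / 2"
  have l: "0 < l" "l \<le> 1" using \<delta> by (auto simp: l_def)
  have "exp l - 1 \<le> l + l\<^sup>2" using exp_le_quadratic[of l] l by simp
  moreover have "0 \<le> exp l - 1" using l by simp
  moreover have "0 \<le> p * real (card A)" using assms by simp
  ultimately have "p * real (card A) * (exp l - 1) \<le> \<mu> * (l + l\<^sup>2)"
    using \<mu> by (intro mult_mono) auto
  then have "p * real (card A) * (exp l - 1) - l * ((1 + \<delta>) * \<mu>) \<le> - (\<mu> * \<delta>\<^sup>2 / 4)"
    by (simp add: l_def field_simps power2_eq_square)
  moreover have "measure_pmf.prob (Pi_pmf E False (\<lambda>_. bernoulli_pmf p))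
      {f. l * ((1 + \<delta>) * \<mu>) \<le> l * real (card {e\<in>A. f e})}
    \<le> exp (p * real (card A) * (exp l - 1) - l * ((1 + \<delta>) * \<mu>))"
    using assms by (intro Pi_bernoulli_chernoff)
  ultimately show ?thesis
    unfolding mult_le_cancel_left_pos[OF l(1)] by (meson exp_le_cancel_iff order.trans)
qed

text \<open>The slack \<open>s\<close> allows the true mean to fall short of \<open>\<mu>\<close>.
  It costs at most a factor \<open>exp s\<close>, because it enters the exponent with coefficient l
  - l^2 \<le> 1.\<close>

lemma Pi_bernoulli_lower_tail:
  fixes p \<delta> \<mu> s :: real
  assumes "finite E" "A \<subseteq> E" "0 \<le> p" "p \<le> 1"
    and \<delta>: "0 < \<delta>" "\<delta> \<le> 1" and \<mu>: "\<mu> - s \<le> p * real (card A)" and s: "0 \<le> s"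
  shows "measure_pmf.prob (Pi_pmf E False (\<lambda>_. bernoulli_pmf p))
      {f. real (card {e\<in>A. f e}) \<le> (1 - \<delta>) * \<mu>} \<le> exp (s - \<mu> * \<delta>\<^sup>2 / 4)"
proof -
  define l where "l = \<delta> / 2"
  have l: "0 < l" "l \<le> 1" and neg: "- l < 0" using \<delta> by (auto simp: l_def)
  have "exp (- l) - 1 \<le> l\<^sup>2 - l" using exp_le_quadratic[of "- l"] l by simp
  then have "p * real (card A) * (exp (- l) - 1) \<le> p * real (card A) * (l\<^sup>2 - l)"
    using assms by (intro mult_left_mono) auto
  \<comment> \<open>The factor l^2 - l is nonpositive for 0 < l \<le> 1, so a lower bound on the
    mean becomes an upper bound here.\<close>
  also have "\<dots> \<le> (\<mu> - s) * (l\<^sup>2 - l)"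
    using \<mu> l by (intro mult_right_mono_neg) (auto simp: power2_eq_square mult_le_cancel_left1)
  also have "\<dots> = \<mu> * (l\<^sup>2 - l) + s * (l - l\<^sup>2)" by (simp add: algebra_simps)
  also have "s * (l - l\<^sup>2) \<le> s * 1"
    using l s zero_le_power2[of l] by (intro mult_left_mono) linarith+
  finally have "p * real (card A) * (exp (- l) - 1) \<le> \<mu> * (l\<^sup>2 - l) + s" by simp
  then have "p * real (card A) * (exp (- l) - 1) - (- l) * ((1 - \<delta>) * \<mu>) \<le> s - \<mu> * \<delta>\<^sup>2 / 4"
    by (simp add: l_def field_simps power2_eq_square)
  moreover have "measure_pmf.prob (Pi_pmf E False (\<lambda>_. bernoulli_pmf p))
      {f. (- l) * ((1 - \<delta>) * \<mu>) \<le> (- l) * real (card {e\<in>A. f e})}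
    \<le> exp (p * real (card A) * (exp (- l) - 1) - (- l) * ((1 - \<delta>) * \<mu>))"
    using assms by (intro Pi_bernoulli_chernoff)
  ultimately show ?thesis
    unfolding mult_le_cancel_left_neg[OF neg] by (meson exp_le_cancel_iff order.trans)
qed

section \<open>Degrees, neighbourhoods and monochromatic edges of the random graph\<close>

text \<open>The degree has mean \<open>d - p\<close> rather than \<open>d\<close>. The upper tail
  tolerates this; the lower tail uses slack 1, costing a factor e \<le> 3, and 1 + 3 gives the
  constant 4.\<close>

lemma prob_degree_deviates:
  fixes p \<delta> d :: real and V :: "'a set"
  assumes V: "finite V" "v \<in> V" and p: "0 \<le> p" "p \<le> 1"
    and \<delta>: "0 < \<delta>" "\<delta> \<le> 1"
  defines "M \<equiv> Pi_pmf (pairs V) False (\<lambda>_. bernoulli_pmf p)"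
  defines "d \<equiv> p * real (card V)"
  shows "measure_pmf.prob M {f. \<bar>real (card {e \<in> {e \<in> pairs V. f e}. v \<in> e}) - d\<bar> > \<delta> * d}
    \<le> 4 * exp (- (d * \<delta>\<^sup>2 / 4))"
proof -
  have *: "{e \<in> {e \<in> pairs V. f e}. v \<in> e} = {e \<in> star V v. f e}" for f
    by (auto simp: star_def)
  have cpos: "card V \<ge> 1" using V by (auto simp: Suc_le_eq card_gt_0_iff)
  have sub: "star V v \<subseteq> pairs V" by (auto simp: star_def)
  have up: "measure_pmf.prob M {f. (1 + \<delta>) * d \<le> real (card {e \<in> star V v. f e})}
      \<le> exp (- (d * \<delta>\<^sup>2 / 4))"
    unfolding M_def using V p \<delta> sub
    by (intro Pi_bernoulli_upper_tail finite_pairs)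
      (auto simp: d_def card_star intro!: mult_left_mono)
  have "measure_pmf.prob M {f. real (card {e \<in> star V v. f e}) \<le> (1 - \<delta>) * d}
      \<le> exp (1 - d * \<delta>\<^sup>2 / 4)"
    unfolding M_def using V p \<delta> sub cpos
    by (intro Pi_bernoulli_lower_tail finite_pairs)
      (auto simp: d_def card_star of_nat_diff algebra_simps)
  also have "\<dots> = exp 1 * exp (- (d * \<delta>\<^sup>2 / 4))"
    by (simp flip: exp_add)
  also have "\<dots> \<le> 3 * exp (- (d * \<delta>\<^sup>2 / 4))"
    using exp_le by (intro mult_right_mono) auto
  finally have low: "measure_pmf.prob M {f. real (card {e \<in> star V v. f e}) \<le> (1 - \<delta>) * d}
      \<le> 3 * exp (- (d * \<delta>\<^sup>2 / 4))" .
  have "measure_pmf.prob M {f. \<bar>real (card {e \<in> star V v. f e}) - d\<bar> > \<delta> * d}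
    \<le> measure_pmf.prob M ({f. (1 + \<delta>) * d \<le> real (card {e \<in> star V v. f e})}
        \<union> {f. real (card {e \<in> star V v. f e}) \<le> (1 - \<delta>) * d})"
    by (intro measure_pmf.finite_measure_mono) (auto simp: algebra_simps)
  also have "\<dots> \<le> measure_pmf.prob M {f. (1 + \<delta>) * d \<le> real (card {e \<in> star V v. f e})}
      + measure_pmf.prob M {f. real (card {e \<in> star V v. f e}) \<le> (1 - \<delta>) * d}"
    by (rule measure_Un_le) auto
  finally show ?thesis using up low unfolding * by linarith
qed

text \<open>The edges at \<open>v\<close> determine the neighbourhood \<open>S\<close> of \<open>v\<close> and are independent
  of the edges inside \<open>S\<close>, so the tail bound applies conditionally on each value of \<open>S\<close>.\<close>

lemma prob_dense_neighbourhood: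
  fixes p \<delta> d :: real and V :: "'a set"
  assumes V: "finite V" "v \<in> V" and p: "0 \<le> p" "p \<le> 1"
    and small: "16 * (real (card V) * p\<^sup>2) \<le> \<delta>"
  defines "M \<equiv> Pi_pmf (pairs V) False (\<lambda>_. bernoulli_pmf p)"
  defines "d \<equiv> p * real (card V)"
  shows "measure_pmf.prob M {f. real (card (nbrs {e \<in> pairs V. f e} v)) \<le> 2 * d \<and>
      real (card ({e \<in> pairs V. f e} \<inter> pairs (nbrs {e \<in> pairs V. f e} v))) > \<delta> * d}
    \<le> exp (- (\<delta> * d / 2))"
proof -
  define \<S> where "\<S> = {S. S \<subseteq> V - {v} \<and> real (card S) \<le> 2 * d}"
  define c where "c S e \<longleftrightarrow> e \<in> (\<lambda>w. {v, w}) ` S" for S e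
  define C where "C S = {f :: 'a set \<Rightarrow> bool. \<forall>e\<in>star V v. f e = c S e}" for S
  define B where "B S = {f. (\<forall>e\<in>star V v. f e = c S e) \<and>
    1 * (\<delta> * d) \<le> 1 * real (card {e\<in>pairs S. f e})}" for S
  have d0: "0 \<le> d" using p by (simp add: d_def)
  have fin\<S>: "finite \<S>" using V by (simp add: \<S>_def)
  have B: "measure_pmf.prob M (B S) \<le> measure_pmf.prob M (C S) * exp (- (\<delta> * d / 2))"
    if S: "S \<in> \<S>" for S
  proof -
    have SV: "S \<subseteq> V - {v}" and cS: "real (card S) \<le> 2 * d" using S by (auto simp: \<S>_def)
    have finS: "finite S" using SV V finite_subset by blast
    have "card (pairs S) \<le> card S * card S"
      unfolding card_pairs[OF finS] choose_two
      by (meson div_le_dividend diff_le_self le_trans mult_le_mono2)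
    then have "real (card (pairs S)) \<le> (real (card S))\<^sup>2"
      unfolding power2_eq_square of_nat_mult[symmetric] of_nat_le_iff .
    also have "\<dots> \<le> (2 * d)\<^sup>2" using cS by (intro power_mono) auto
    finally have "p * real (card (pairs S)) \<le> p * (2 * d)\<^sup>2"
      using p by (intro mult_left_mono) auto
    also have "p * (2 * d)\<^sup>2 = 4 * (real (card V) * p\<^sup>2) * d"
      by (simp add: d_def power2_eq_square)
    \<comment> \<open>With \<open>l = 1\<close> and exp 1 - 1 \<le> 2 the mean contributes at most 8
      n p^2 d; the 16 in \<open>small\<close> makes this at most half of
      \<open>\<delta> * d\<close>.\<close>
    finally have "p * real (card (pairs S)) * (exp 1 - 1) \<le> (4 * (real (card V) * p\<^sup>2) * d) * 2"
      by (rule mult_mono) (use exp_le p d0 in auto)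
    also have "\<dots> = 16 * (real (card V) * p\<^sup>2) * d / 2" by simp
    also have "\<dots> \<le> \<delta> * d / 2"
      using small d0 by (intro divide_right_mono mult_right_mono) auto
    finally have exponent: "p * real (card (pairs S)) * (exp 1 - 1) - 1 * (\<delta> * d) \<le> - (\<delta> * d / 2)"
      by simp
    have "measure_pmf.prob M (B S) \<le> measure_pmf.prob M (C S) *
        exp (p * real (card (pairs S)) * (exp 1 - 1) - 1 * (\<delta> * d))"
      unfolding M_def B_def C_def using SV V p
      by (intro Pi_bernoulli_cylinder_chernoff finite_pairs) (auto simp: star_def pairs_def)
    also have "\<dots> \<le> measure_pmf.prob M (C S) * exp (- (\<delta> * d / 2))"
      using exponent by (intro mult_left_mono) auto
    finally show ?thesis .
  qed
  \<comment> \<open>The star at \<open>v\<close> determines \<open>S\<close>, so the cylinders are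
    disjoint and their probabilities sum to at most 1. Summing over all \<open>S\<close> therefore
    costs no factor for the number of sets.\<close>
  have disj: "disjoint_family_on C \<S>"
  proof (unfold disjoint_family_on_def, intro ballI impI)
    fix S T assume ST: "S \<in> \<S>" "T \<in> \<S>" "S \<noteq> T"
    have "S = T" if "f \<in> C S" "f \<in> C T" for f
    proof -
      have "w \<in> S \<longleftrightarrow> w \<in> T" if "w \<in> V - {v}" for w
      proof -
        have w: "{v, w} \<in> star V v" using that V by (auto simp: star_def)
        have "c S {v, w} = c T {v, w}" using \<open>f \<in> C S\<close> \<open>f \<in> C T\<close> w by (auto simp: C_def)
        then show ?thesis by (auto simp: c_def doubleton_eq_iff)
      qed
      then show ?thesis using ST by (auto simp: \<S>_def)
    qed
    then show "C S \<inter> C T = {}" using ST by auto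
  qed
  have "f \<in> (\<Union>S\<in>\<S>. B S)"
    if "real (card (nbrs {e \<in> pairs V. f e} v)) \<le> 2 * d"
      "real (card ({e \<in> pairs V. f e} \<inter> pairs (nbrs {e \<in> pairs V. f e} v))) > \<delta> * d" for f
  proof -
    define S where "S = nbrs {e \<in> pairs V. f e} v"
    have SV: "S \<subseteq> V - {v}" unfolding S_def by (rule nbrs_subset) auto
    then have "S \<in> \<S>" using that by (simp add: \<S>_def S_def)
    moreover have "f e = c S e" if "e \<in> star V v" for e
    proof -
      obtain w where "e = {v, w}" "w \<in> V - {v}" using \<open>e \<in> star V v\<close> V by (auto simp: star_eq_image)
      then show ?thesis using V by (auto simp: c_def S_def nbrs_def doubleton_eq_iff)
    qed
    moreover have "{e \<in> pairs V. f e} \<inter> pairs S = {e \<in> pairs S. f e}"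
      using SV by (auto simp: pairs_def)
    ultimately show ?thesis using that unfolding S_def[symmetric] by (auto simp: B_def)
  qed
  then have "{f. real (card (nbrs {e \<in> pairs V. f e} v)) \<le> 2 * d \<and>
      real (card ({e \<in> pairs V. f e} \<inter> pairs (nbrs {e \<in> pairs V. f e} v))) > \<delta> * d}
    \<subseteq> (\<Union>S\<in>\<S>. B S)" by blast
  then have "measure_pmf.prob M {f. real (card (nbrs {e \<in> pairs V. f e} v)) \<le> 2 * d \<and>
      real (card ({e \<in> pairs V. f e} \<inter> pairs (nbrs {e \<in> pairs V. f e} v))) > \<delta> * d}
    \<le> measure_pmf.prob M (\<Union>S\<in>\<S>. B S)"
    by (rule measure_pmf.finite_measure_mono) simp
  also have "\<dots> \<le> (\<Sum>S\<in>\<S>. measure_pmf.prob M (B S))"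
    using fin\<S> by (intro measure_pmf.finite_measure_subadditive_finite) auto
  also have "\<dots> \<le> (\<Sum>S\<in>\<S>. measure_pmf.prob M (C S) * exp (- (\<delta> * d / 2)))"
    by (intro sum_mono B)
  also have "\<dots> = (\<Sum>S\<in>\<S>. measure_pmf.prob M (C S)) * exp (- (\<delta> * d / 2))"
    by (simp add: sum_distrib_right)
  also have "(\<Sum>S\<in>\<S>. measure_pmf.prob M (C S)) = measure_pmf.prob M (\<Union>S\<in>\<S>. C S)"
    using fin\<S> disj by (intro measure_pmf.finite_measure_finite_Union[symmetric]) auto
  also have "\<dots> * exp (- (\<delta> * d / 2)) \<le> 1 * exp (- (\<delta> * d / 2))"
    by (intro mult_right_mono) auto
  finally show ?thesis by simp
qed

text \<open>The term -n/2 in the count of monochromatic pairs, multiplied by p \<le> 1, is absorbed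
  by slack n in the lower tail. The resulting factor \<open>exp n\<close> is harmless, since the
  gain in the exponent has order \<open>d * n\<close> and \<open>d\<close> will tend to
  infinity.\<close>

lemma prob_few_mono_edges:
  fixes p \<delta> d :: real and V :: "'a set"
  assumes V: "finite V" and p: "0 \<le> p" "p \<le> 1"
    and \<delta>: "0 < \<delta>" "\<delta> \<le> 1" and q: "q \<ge> 1" and \<phi>: "\<phi> \<in> V \<rightarrow> {1..q}"
  defines "M \<equiv> Pi_pmf (pairs V) False (\<lambda>_. bernoulli_pmf p)"
  defines "d \<equiv> p * real (card V)"
  shows "measure_pmf.prob M {f. real (card ({e \<in> pairs V. f e} \<inter> mono_pairs V \<phi>))
      < (1 - \<delta>) * (d * real (card V) / (2 * real q))}
    \<le> exp (real (card V) * (1 - d * (\<delta>\<^sup>2 / (8 * real q))))"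
proof -
  define \<mu> where "\<mu> = d * real (card V) / (2 * real q)"
  have *: "{e \<in> pairs V. f e} \<inter> mono_pairs V \<phi> = {e \<in> mono_pairs V \<phi>. f e}" for f
    by (auto simp: mono_pairs_def)
  have "p * ((real (card V))\<^sup>2 / (2 * real q) - real (card V) / 2) \<le> p * real (card (mono_pairs V \<phi>))"
    using card_mono_pairs_ge[OF V \<phi> q] p by (intro mult_left_mono)
  moreover have "p * ((real (card V))\<^sup>2 / (2 * real q) - real (card V) / 2) = \<mu> - p * real (card V) / 2"
    by (simp add: \<mu>_def d_def power2_eq_square algebra_simps)
  moreover have "p * real (card V) \<le> 1 * real (card V)" using p by (intro mult_right_mono) auto
  ultimately have \<mu>: "\<mu> - real (card V) \<le> p * real (card (mono_pairs V \<phi>))" by linarith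
  have "measure_pmf.prob M {f. real (card {e \<in> mono_pairs V \<phi>. f e}) < (1 - \<delta>) * \<mu>}
    \<le> measure_pmf.prob M {f. real (card {e \<in> mono_pairs V \<phi>. f e}) \<le> (1 - \<delta>) * \<mu>}"
    by (intro measure_pmf.finite_measure_mono) auto
  also have "\<dots> \<le> exp (real (card V) - \<mu> * \<delta>\<^sup>2 / 4)"
    unfolding M_def using V p \<delta> \<mu>
    by (intro Pi_bernoulli_lower_tail finite_pairs) (auto simp: mono_pairs_def)
  also have "real (card V) - \<mu> * \<delta>\<^sup>2 / 4 = real (card V) * (1 - d * (\<delta>\<^sup>2 / (8 * real q)))"
    by (simp add: \<mu>_def algebra_simps)
  finally show ?thesis unfolding * \<mu>_def .
qed

section \<open>Quasirandom edge sets and the removal of triangle edges\<close>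

text \<open>These properties separate the probabilistic from the deterministic half;
  \<open>d\<close> stands for the expected degree pn. The last clause is one-sided because the upper
  bound on \<open>del\<close> comes from averaging over colourings.\<close>

definition quasirandom :: "nat \<Rightarrow> real \<Rightarrow> real \<Rightarrow> 'a set \<Rightarrow> 'a set set \<Rightarrow> bool" where
  "quasirandom q d \<delta> V F \<longleftrightarrow>
    (\<forall>v\<in>V. \<bar>real (card {e \<in> F. v \<in> e}) - d\<bar> \<le> \<delta> * d) \<and>
    (\<forall>v\<in>V. real (card (F \<inter> pairs (nbrs F v))) \<le> \<delta> * d) \<and>
    (\<forall>\<phi>\<in>V \<rightarrow>\<^sub>E {1..q}. real (card (F \<inter> mono_pairs V \<phi>)) \<ge> (1 - \<delta>) * (d * real (card V) / (2 * real q)))"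

text \<open>A union bound over vertices for the first two clauses and over all q^n colourings for
  the third.\<close>

lemma prob_not_quasirandom:
  fixes p \<delta> d :: real and V :: "'a set"
  assumes V: "finite V" and p: "0 \<le> p" "p \<le> 1"
    and \<delta>: "0 < \<delta>" "\<delta> \<le> 1" and q: "q \<ge> 1"
    and small: "16 * (real (card V) * p\<^sup>2) \<le> \<delta>"
  defines "M \<equiv> Pi_pmf (pairs V) False (\<lambda>_. bernoulli_pmf p)"
  defines "d \<equiv> p * real (card V)"
  shows "measure_pmf.prob M {f. \<not> quasirandom q d \<delta> V {e \<in> pairs V. f e}}
    \<le> real (card V) * (4 * exp (- (d * \<delta>\<^sup>2 / 4))) + real (card V) * exp (- (\<delta> * d / 2))
      + real q ^ card V * exp (real (card V) * (1 - d * (\<delta>\<^sup>2 / (8 * real q))))"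
proof -
  define F where "F f = {e \<in> pairs V. f e}" for f
  define B1 where "B1 v = {f. \<bar>real (card {e \<in> F f. v \<in> e}) - d\<bar> > \<delta> * d}" for v
  define B2 where "B2 v = {f. real (card (nbrs (F f) v)) \<le> 2 * d \<and>
    real (card (F f \<inter> pairs (nbrs (F f) v))) > \<delta> * d}" for v
  define B3 where "B3 \<phi> = {f. real (card (F f \<inter> mono_pairs V \<phi>))
    < (1 - \<delta>) * (d * real (card V) / (2 * real q))}" for \<phi>
  let ?C = "V \<rightarrow>\<^sub>E {1..q}"
  have finC: "finite ?C" using V by (intro finite_PiE) auto
  have d0: "0 \<le> d" using p by (simp add: d_def)
  have "f \<in> (\<Union>v\<in>V. B1 v) \<union> (\<Union>v\<in>V. B2 v) \<union> (\<Union>\<phi>\<in>?C. B3 \<phi>)"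
    if bad: "\<not> quasirandom q d \<delta> V (F f)" for f
  proof (rule ccontr)
    assume notin: "\<not> ?thesis"
    have deg: "\<bar>real (card {e \<in> F f. v \<in> e}) - d\<bar> \<le> \<delta> * d" if "v \<in> V" for v
      using notin that by (force simp: B1_def)
    have "real (card (F f \<inter> pairs (nbrs (F f) v))) \<le> \<delta> * d" if "v \<in> V" for v
    proof -
      have "card (nbrs (F f) v) = card {e \<in> F f. v \<in> e}"
        by (rule card_edges_at[symmetric, of _ V]) (auto simp: F_def)
      \<comment> \<open>The degree clause with \<delta> \<le> 1 supplies the cap
        \<open>2 * d\<close> on the neighbourhood that is built into \<open>B2\<close>.\<close>
      moreover have "\<delta> * d \<le> 1 * d" using \<delta> d0 by (intro mult_right_mono) auto
      ultimately have "real (card (nbrs (F f) v)) \<le> 2 * d" using deg[OF that] by simp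
      then show ?thesis using notin that by (force simp: B2_def)
    qed
    moreover have "real (card (F f \<inter> mono_pairs V \<phi>)) \<ge> (1 - \<delta>) * (d * real (card V) / (2 * real q))"
      if "\<phi> \<in> ?C" for \<phi> using notin that by (force simp: B3_def)
    ultimately show False using bad deg by (auto simp: quasirandom_def)
  qed
  then have "{f. \<not> quasirandom q d \<delta> V (F f)}
    \<subseteq> (\<Union>v\<in>V. B1 v) \<union> (\<Union>v\<in>V. B2 v) \<union> (\<Union>\<phi>\<in>?C. B3 \<phi>)" by blast
  then have "measure_pmf.prob M {f. \<not> quasirandom q d \<delta> V (F f)}
    \<le> measure_pmf.prob M ((\<Union>v\<in>V. B1 v) \<union> (\<Union>v\<in>V. B2 v) \<union> (\<Union>\<phi>\<in>?C. B3 \<phi>))"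
    by (rule measure_pmf.finite_measure_mono) simp
  also have "\<dots> \<le> measure_pmf.prob M (\<Union>v\<in>V. B1 v) + measure_pmf.prob M (\<Union>v\<in>V. B2 v)
      + measure_pmf.prob M (\<Union>\<phi>\<in>?C. B3 \<phi>)"
    by (intro order.trans[OF measure_Un_le] add_right_mono measure_Un_le) auto
  also have "\<dots> \<le> (\<Sum>v\<in>V. measure_pmf.prob M (B1 v)) + (\<Sum>v\<in>V. measure_pmf.prob M (B2 v))
      + (\<Sum>\<phi>\<in>?C. measure_pmf.prob M (B3 \<phi>))"
    using V finC by (intro add_mono measure_pmf.finite_measure_subadditive_finite) auto
  also have "\<dots> \<le> (\<Sum>v\<in>V. 4 * exp (- (d * \<delta>\<^sup>2 / 4))) + (\<Sum>v\<in>V. exp (- (\<delta> * d / 2)))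
      + (\<Sum>\<phi>\<in>?C. exp (real (card V) * (1 - d * (\<delta>\<^sup>2 / (8 * real q)))))"
    unfolding B1_def B2_def B3_def F_def M_def d_def using V p \<delta> q small
    by (intro add_mono sum_mono prob_degree_deviates prob_dense_neighbourhood prob_few_mono_edges)
      auto
  finally show ?thesis using V by (simp add: F_def card_PiE)
qed

text \<open>A degree is off by at most \<delta>d in \<open>F\<close> and loses at most 2\<delta>d,
  which gives the 3. Summed over vertices, at most \<delta>dn edges disappear; averaging bounds
  \<open>del\<close> from above, and the last clause of \<open>quasirandom\<close> minus this loss
  bounds it from below.\<close>

lemma quasirandom_triangle_removal:
  fixes d \<delta> :: real and V :: "'a set"
  assumes V: "finite V" "V \<noteq> {}" and F: "F \<subseteq> pairs V" and q: "q \<ge> 1"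
    and d: "0 \<le> d" "0 \<le> \<delta>" and qr: "quasirandom q d \<delta> V F"
  defines "H \<equiv> \<lparr>verts = V, edges = F - triangle_edges F\<rparr>"
  shows "\<bar>real (min_degree H) - d\<bar> \<le> 3 * \<delta> * d"
    and "\<bar>real (del q H) - 1 / (2 * real q) * (d * real (card V))\<bar> \<le> 3 * \<delta> * (d * real (card V))"
proof -
  let ?n = "real (card V)" and ?T = "triangle_edges F"
  have deg: "\<bar>real (card {e \<in> F. v \<in> e}) - d\<bar> \<le> \<delta> * d"
    and nb: "real (card (F \<inter> pairs (nbrs F v))) \<le> \<delta> * d" if "v \<in> V" for v
    using qr that by (auto simp: quasirandom_def)
  have TF: "?T \<subseteq> F" by (auto simp: triangle_edges_def)
  have finF: "finite F" using V F finite_pairs finite_subset by blast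
  have finT: "finite ?T" using finF TF finite_subset by blast
  have Tat: "real (card {e \<in> ?T. v \<in> e}) \<le> 2 * (\<delta> * d)" if "v \<in> V" for v
    using card_triangle_edges_at_le[OF V(1) F, of v] nb[OF that] by linarith
  have degH: "real (degree H v) = real (card {e \<in> F. v \<in> e}) - real (card {e \<in> ?T. v \<in> e})" for v
  proof -
    have "{e \<in> F - ?T. v \<in> e} = {e \<in> F. v \<in> e} - {e \<in> ?T. v \<in> e}" by auto
    moreover have "{e \<in> ?T. v \<in> e} \<subseteq> {e \<in> F. v \<in> e}" using TF by auto
    ultimately show ?thesis using finF finT
      by (simp add: degree_def H_def card_Diff_subset of_nat_diff card_mono)
  qed
  have "min_degree H \<in> degree H ` V"
    unfolding min_degree_def using V by (simp add: H_def Min_in)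
  then obtain v where v: "v \<in> V" "min_degree H = degree H v" by auto
  have "0 \<le> \<delta> * d" using d by simp
  then show "\<bar>real (min_degree H) - d\<bar> \<le> 3 * \<delta> * d"
    using deg[OF v(1)] Tat[OF v(1)] degH[of v] v(2) by linarith
  have "2 * real (card ?T) = (\<Sum>v\<in>V. real (card {e \<in> ?T. v \<in> e}))"
    using handshake[of V ?T] V F TF by (simp add: of_nat_sum[symmetric] del: of_nat_sum)
  also have "\<dots> \<le> (\<Sum>v\<in>V. 2 * (\<delta> * d))" by (intro sum_mono Tat)
  finally have T: "real (card ?T) \<le> \<delta> * (d * ?n)" by (simp add: algebra_simps)
  have "2 * real (card F) = (\<Sum>v\<in>V. real (card {e \<in> F. v \<in> e}))"
    using handshake[of V F] V F by (simp add: of_nat_sum[symmetric] del: of_nat_sum)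
  also have "\<dots> \<le> (\<Sum>v\<in>V. (1 + \<delta>) * d)"
    using deg by (intro sum_mono) (fastforce simp: algebra_simps)
  finally have cF: "2 * real (card F) \<le> (1 + \<delta>) * (d * ?n)" by (simp add: algebra_simps)
  have dn: "0 \<le> \<delta> * (d * ?n)" using d by simp
  then have dnq: "\<delta> * (d * ?n) / (2 * real q) \<le> \<delta> * (d * ?n) / 1"
    using q by (intro divide_left_mono) auto
  have EH: "edges H \<subseteq> pairs V" using F by (auto simp: H_def)
  have "q * del q H \<le> card (edges H)"
    using V q EH by (intro del_le_average) (auto simp: H_def)
  also have "\<dots> \<le> card F" using finF by (auto simp: H_def intro: card_mono)
  finally have "real q * real (del q H) \<le> real (card F)" by (simp flip: of_nat_mult)
  then have "real (del q H) \<le> (1 + \<delta>) * (d * ?n) / (2 * real q)"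
    using cF q by (simp add: field_simps)
  then have up: "real (del q H) \<le> 1 / (2 * real q) * (d * ?n) + \<delta> * (d * ?n) / (2 * real q)"
    by (simp add: add_divide_distrib algebra_simps)
  have "del q H \<in> (\<lambda>\<phi>. card (mono_edges H \<phi>)) ` (V \<rightarrow>\<^sub>E {1..q})"
    unfolding del_def using V q
    by (subst (1) H_def) (auto simp: H_def PiE_eq_empty_iff intro!: Min_in finite_PiE)
  then obtain \<phi> where \<phi>: "\<phi> \<in> V \<rightarrow>\<^sub>E {1..q}" "del q H = card (mono_edges H \<phi>)" by auto
  \<comment> \<open>For the optimal colouring of \<open>H\<close>, every monochromatic edge of
    \<open>F\<close> survives in \<open>H\<close> or was removed.\<close>
  have "card (F \<inter> mono_pairs V \<phi>) \<le> card ((edges H \<inter> mono_pairs V \<phi>) \<union> ?T)"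
    using finF finT by (intro card_mono) (auto simp: H_def)
  also have "\<dots> \<le> card (edges H \<inter> mono_pairs V \<phi>) + card ?T" by (rule card_Un_le)
  also have "card (edges H \<inter> mono_pairs V \<phi>) = del q H"
    using EH \<phi> by (simp add: mono_edges_eq)
  finally have "real (card (F \<inter> mono_pairs V \<phi>)) \<le> real (del q H) + real (card ?T)" by linarith
  moreover have "(1 - \<delta>) * (d * ?n / (2 * real q)) \<le> real (card (F \<inter> mono_pairs V \<phi>))"
    using qr \<phi> by (auto simp: quasirandom_def)
  moreover have "(1 - \<delta>) * (d * ?n / (2 * real q)) = 1 / (2 * real q) * (d * ?n) - \<delta> * (d * ?n) / (2 * real q)"
    by (simp add: algebra_simps diff_divide_distrib)
  ultimately show "\<bar>real (del q H) - 1 / (2 * real q) * (d * ?n)\<bar> \<le> 3 * \<delta> * (d * ?n)"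
    using up T dnq dn by (simp add: mult.assoc)
qed

section \<open>Asymptotics and conclusion\<close>

lemma prob_gnp:
  "measure_pmf.prob (gnp n p) {\<Gamma>. P \<Gamma>} =
    measure_pmf.prob (Pi_pmf (pairs {1..n}) False (\<lambda>_. bernoulli_pmf p))
      {f. P \<lparr>verts = {1..n}, edges = {e \<in> pairs {1..n}. f e}\<rparr>}"
  by (simp add: gnp_def vimage_def)

text \<open>Eventually d \<ge> (2/c) ln n, so the exponential is at most n^(-2) and survives the
  union bound over n vertices.\<close>

lemma tendsto_real_times_exp_neg:
  fixes d :: "nat \<Rightarrow> real"
  assumes "filterlim (\<lambda>n. d n / ln (real n)) at_top sequentially" "c > 0"
  shows "(\<lambda>n. real n * exp (- (c * d n))) \<longlonglongrightarrow> 0"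
proof (rule tendsto_sandwich[where f = "\<lambda>_. 0"])
  have "eventually (\<lambda>n. 2 / c \<le> d n / ln (real n)) sequentially"
    using assms(1) by (simp add: filterlim_at_top)
  then show "eventually (\<lambda>n. real n * exp (- (c * d n)) \<le> 1 / real n) sequentially"
    using eventually_ge_at_top[of 2]
  proof eventually_elim
    case (elim n)
    have "2 * ln (real n) \<le> c * d n" using elim assms(2) by (simp add: field_simps)
    then have "exp (- (c * d n)) \<le> exp (- (2 * ln (real n)))" by simp
    also have "\<dots> = 1 / (real n)\<^sup>2"
      using elim exp_of_nat_mult[of 2 "ln (real n)"] by (simp add: exp_minus inverse_eq_divide)
    finally have "real n * exp (- (c * d n)) \<le> real n * (1 / (real n)\<^sup>2)"
      by (intro mult_left_mono) auto
    then show ?case using elim by (simp add: power2_eq_square)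
  qed
  show "(\<lambda>n. 1 / real n) \<longlonglongrightarrow> 0" by real_asymp
qed (auto intro!: always_eventually)

text \<open>The threshold (ln q + 2)/c pays for the q^n colourings and for the factor
  \<open>exp n\<close> from the slack, and still leaves \<open>exp (- n)\<close>.\<close>

lemma tendsto_power_times_exp_neg:
  fixes d :: "nat \<Rightarrow> real"
  assumes "filterlim d at_top sequentially" "c > 0" "q \<ge> (1 :: nat)"
  shows "(\<lambda>n. real q ^ n * exp (real n * (1 - d n * c))) \<longlonglongrightarrow> 0"
proof (rule tendsto_sandwich[where f = "\<lambda>_. 0"])
  have "eventually (\<lambda>n. (ln (real q) + 2) / c \<le> d n) sequentially"
    using assms(1) by (simp add: filterlim_at_top)
  then show "eventually (\<lambda>n. real q ^ n * exp (real n * (1 - d n * c)) \<le> exp (- real n)) sequentially"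
  proof eventually_elim
    case (elim n)
    then have le: "ln (real q) + (1 - d n * c) \<le> - 1" using assms(2) by (simp add: field_simps)
    have "real q ^ n * exp (real n * (1 - d n * c)) = exp (real n * (ln (real q) + (1 - d n * c)))"
      using assms(3) by (simp add: exp_of_nat_mult exp_add power_mult_distrib)
    also have "\<dots> \<le> exp (real n * - 1)"
      using mult_left_mono[OF le, of "real n"] by simp
    finally show ?case by simp
  qed
  show "(\<lambda>n. exp (- real n)) \<longlonglongrightarrow> 0" by real_asymp
qed (auto intro!: always_eventually)

theorem lemma5p3:
  fixes q :: nat and p :: "nat \<Rightarrow> real"
  assumes "q \<ge> 2"
    and "\<And>n. n \<ge> 1 \<Longrightarrow> 0 < p n \<and> p n \<le> 1"
    and "filterlim (\<lambda>n. p n * real n / ln (real n)) at_top sequentially"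
    and "(\<lambda>n. real n * (p n)\<^sup>2) \<longlonglongrightarrow> 0"
  shows "\<exists>\<alpha> \<beta> :: nat \<Rightarrow> real. \<alpha> \<longlonglongrightarrow> 0 \<and> \<beta> \<longlonglongrightarrow> 0 \<and>
    aas (\<lambda>n. gnp n (p n))
      (\<lambda>n \<Gamma>. \<exists>H. spanning_subgraph H \<Gamma> \<and> triangle_free H \<and>
         \<bar>real (min_degree H) - p n * real n\<bar> \<le> \<alpha> n * (p n * real n) \<and>
         \<bar>real (del q H) - 1 / (2 * real q) * (p n * (real n)\<^sup>2)\<bar> \<le> \<beta> n * (p n * (real n)\<^sup>2))"
proof -
  define good where "good n \<epsilon> \<Gamma> \<longleftrightarrow> (\<exists>H. spanning_subgraph H \<Gamma> \<and> triangle_free H \<and>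
      \<bar>real (min_degree H) - p n * real n\<bar> \<le> \<epsilon> * (p n * real n) \<and>
      \<bar>real (del q H) - 1 / (2 * real q) * (p n * (real n)\<^sup>2)\<bar> \<le> \<epsilon> * (p n * (real n)\<^sup>2))"
    for n \<epsilon> and \<Gamma> :: "nat ugraph"
  define d where "d n = p n * real n" for n
  have q1: "q \<ge> 1" using assms(1) by simp
  have d_ln: "filterlim (\<lambda>n. d n / ln (real n)) at_top sequentially"
    using assms(3) by (simp add: d_def)
  have d_top: "filterlim d at_top sequentially"
  proof (rule filterlim_at_top_mono)
    show "filterlim (\<lambda>n. ln (real n)) at_top sequentially" by real_asymp
    have "eventually (\<lambda>n. 1 \<le> d n / ln (real n)) sequentially"
      using d_ln by (simp add: filterlim_at_top)
    then show "eventually (\<lambda>n. ln (real n) \<le> d n) sequentially"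
      using eventually_ge_at_top[of 2] by eventually_elim (simp add: field_simps)
  qed
  \<comment> \<open>One \<open>\<epsilon>\<close> bounds both relative errors and the failure
    probability, so one null sequence will serve as \<open>\<alpha>\<close> and
    \<open>\<beta>\<close>.\<close>
  have "eventually (\<lambda>n. measure_pmf.prob (gnp n (p n)) {\<Gamma>. good n \<epsilon> \<Gamma>} \<ge> 1 - \<epsilon>) sequentially"
    if \<epsilon>: "\<epsilon> > 0" for \<epsilon>
  proof -
    \<comment> \<open>Removal turns error \<delta> into 3\<delta>, and the tail bounds require
      \<delta> \<le> 1.\<close>
    define \<delta> where "\<delta> = min 1 (\<epsilon> / 3)"
    have \<delta>: "0 < \<delta>" "\<delta> \<le> 1" "3 * \<delta> \<le> \<epsilon>" using \<epsilon> by (auto simp: \<delta>_def)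
    define b where "b n = real n * (4 * exp (- (d n * \<delta>\<^sup>2 / 4))) + real n * exp (- (\<delta> * d n / 2))
      + real q ^ n * exp (real n * (1 - d n * (\<delta>\<^sup>2 / (8 * real q))))" for n
    have "(\<lambda>n. 4 * (real n * exp (- ((\<delta>\<^sup>2 / 4) * d n))) + real n * exp (- ((\<delta> / 2) * d n))
      + real q ^ n * exp (real n * (1 - d n * (\<delta>\<^sup>2 / (8 * real q))))) \<longlonglongrightarrow> 4 * 0 + 0 + 0"
      using \<delta> q1 d_ln d_top
      by (intro tendsto_add tendsto_mult tendsto_const tendsto_real_times_exp_neg
          tendsto_power_times_exp_neg) auto
    then have "b \<longlonglongrightarrow> 0" by (simp add: b_def[abs_def] mult_ac)
    then have "eventually (\<lambda>n. b n < \<epsilon>) sequentially" using \<epsilon> by (rule order_tendstoD)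
    moreover have "eventually (\<lambda>n. real n * (p n)\<^sup>2 < \<delta> / 16) sequentially"
      using assms(4) \<delta> by (intro order_tendstoD) auto
    \<comment> \<open>For n \<ge> 1 the bounds on \<open>p n\<close> are available and the vertex
      set is nonempty, so \<open>min_degree\<close> is a genuine minimum.\<close>
    ultimately show ?thesis using eventually_ge_at_top[of 1]
    proof eventually_elim
      case (elim n)
      let ?V = "{1..n}" and ?M = "Pi_pmf (pairs {1..n}) False (\<lambda>_. bernoulli_pmf (p n))"
      have p: "0 < p n" "p n \<le> 1" using assms(2) elim by auto
      have "measure_pmf.prob ?M {f. \<not> quasirandom q (p n * real (card ?V)) \<delta> ?V {e \<in> pairs ?V. f e}}
          \<le> b n"
        using prob_not_quasirandom[of ?V "p n" \<delta> q] p \<delta> q1 elim by (simp add: b_def d_def)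
      then have bad: "measure_pmf.prob ?M {f. \<not> quasirandom q (d n) \<delta> ?V {e \<in> pairs ?V. f e}} \<le> b n"
        by (simp add: d_def)
      have "good n \<epsilon> \<lparr>verts = ?V, edges = F\<rparr>"
        if qr: "quasirandom q (d n) \<delta> ?V F" and F: "F \<subseteq> pairs ?V" for F
      proof -
        let ?H = "\<lparr>verts = ?V, edges = F - triangle_edges F\<rparr>"
        have d0: "0 \<le> d n" using p by (simp add: d_def)
        have le: "3 * \<delta> * x \<le> \<epsilon> * x" if "0 \<le> x" for x
          using \<delta> that by (intro mult_right_mono)
        have dn: "p n * real n = d n" "p n * (real n)\<^sup>2 = d n * real n"
          by (auto simp: d_def power2_eq_square)
        show ?thesis
          unfolding good_def dn
        proof (intro exI[of _ ?H] conjI)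
          show "spanning_subgraph ?H \<lparr>verts = ?V, edges = F\<rparr>"
            using F by (auto simp: spanning_subgraph_def simple_graph_def)
          show "triangle_free ?H" by (rule triangle_free_minus_triangle_edges)
          have "\<bar>real (min_degree ?H) - d n\<bar> \<le> 3 * \<delta> * d n"
            using elim F q1 d0 \<delta> qr by (intro quasirandom_triangle_removal(1)) auto
          also have "\<dots> \<le> \<epsilon> * d n" using d0 by (rule le)
          finally show "\<bar>real (min_degree ?H) - d n\<bar> \<le> \<epsilon> * d n" .
          have "\<bar>real (del q ?H) - 1 / (2 * real q) * (d n * real (card ?V))\<bar>
              \<le> 3 * \<delta> * (d n * real (card ?V))"
            using elim F q1 d0 \<delta> qr by (intro quasirandom_triangle_removal(2)) auto
          also have "\<dots> \<le> \<epsilon> * (d n * real (card ?V))" using d0 by (intro le) simp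
          finally show "\<bar>real (del q ?H) - 1 / (2 * real q) * (d n * real n)\<bar> \<le> \<epsilon> * (d n * real n)"
            by simp
        qed
      qed
      then have "measure_pmf.prob ?M {f. quasirandom q (d n) \<delta> ?V {e \<in> pairs ?V. f e}}
          \<le> measure_pmf.prob (gnp n (p n)) {\<Gamma>. good n \<epsilon> \<Gamma>}"
        unfolding prob_gnp by (intro measure_pmf.finite_measure_mono) auto
      moreover have "measure_pmf.prob ?M {f. quasirandom q (d n) \<delta> ?V {e \<in> pairs ?V. f e}}
          = 1 - measure_pmf.prob ?M {f. \<not> quasirandom q (d n) \<delta> ?V {e \<in> pairs ?V. f e}}"
        using measure_pmf.prob_neg[of ?M "\<lambda>f. \<not> quasirandom q (d n) \<delta> ?V {e \<in> pairs ?V. f e}"]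
        by simp
      ultimately show ?case using bad elim by linarith
    qed
  qed
  \<comment> \<open>At tolerance 1 the required probability is merely at least 0, which settles the
    second premise for every \<open>n\<close>.\<close>
  then obtain \<epsilon> where \<epsilon>: "\<epsilon> \<longlonglongrightarrow> 0"
    "\<And>n. measure_pmf.prob (gnp n (p n)) {\<Gamma>. good n (\<epsilon> n) \<Gamma>} \<ge> 1 - \<epsilon> n"
    using exists_null_sequence_of_eventually[of
        "\<lambda>n \<epsilon>. measure_pmf.prob (gnp n (p n)) {\<Gamma>. good n \<epsilon> \<Gamma>} \<ge> 1 - \<epsilon>"] by auto
  have "(\<lambda>n. measure_pmf.prob (gnp n (p n)) {\<Gamma>. good n (\<epsilon> n) \<Gamma>}) \<longlonglongrightarrow> 1"
  proof (rule tendsto_sandwich)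
    show "(\<lambda>n. 1 - \<epsilon> n) \<longlonglongrightarrow> 1" using tendsto_diff[OF tendsto_const \<epsilon>(1), of 1] by simp
  qed (use \<epsilon>(2) in auto)
  then have "aas (\<lambda>n. gnp n (p n)) (\<lambda>n. good n (\<epsilon> n))" by (simp add: aas_def)
  then show ?thesis using \<epsilon>(1) unfolding good_def by blast
qed

end
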